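(* Let $\varepsilon>0$. There is a constant depending only on $\varepsilon$ such that for all real $Q_1\ge1$, $N\ge1$ and every sequence $(a_n)$ of complex numbers, with $S(\alpha):=\sum_{n\le N}a_ne(n\alpha)$ and $Z:=\sum_{n\le N}|a_n|^2$, $$\sum_{q\le Q_1}\ \sum_{\substack{a=1\\(a,q)=1}}^{q^2}\left|S\!\left(\frac{a}{q^2}\right)\right|^2\ll(\log\log 10NQ_1)^2\left(Q_1^3+N+N^{1/2+\varepsilon}Q_1^2\right)Z,$$ where $q$ ranges over positive integers.
   Context: $e(x)=e^{2\pi i x}$. Sums over $n\le N$ are over positive integers. *)

theory Defs
  imports Complex_Main
begin

definition e :: "real \<Rightarrow> complex" where
  "e x = exp (2 * of_real pi * \<i> * of_real x)"

definition pos_upto :: "real \<Rightarrow> nat set" where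
  "pos_upto x = {n. 1 \<le> n \<and> real n \<le> x}"

definition trig_poly :: "(nat \<Rightarrow> complex) \<Rightarrow> real \<Rightarrow> real \<Rightarrow> complex" where
  "trig_poly a N \<alpha> = (\<Sum>n\<in>pos_upto N. a n * e (real n * \<alpha>))"

end

theory Submission
  imports Defs "HOL-Analysis.Kronecker_Approximation_Theorem" "HOL-Computational_Algebra.Primes"
begin

text \<open>Let \<open>M = \<lfloor>N\<rfloor>\<close>. Comparing \<open>S(\<alpha>)\<close> with its partial sums at the nearest grid point
  \<open>k / M\<close> by Abel summation, and applying orthogonality on the grid, the left-hand side is
  \<open>O(K M Z)\<close>, where \<open>K\<close> bounds the number of fractions \<open>a / q\<^sup>2\<close> in any interval
  \<open>(\<beta> - 1 / M, \<beta>]\<close>. If \<open>M \<le> Q\<^sup>2\<close>, counting for each \<open>q\<close> separately gives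
  \<open>K = O(Q\<^sup>3 / M)\<close>. Otherwise approximate \<open>\<beta>\<close> by \<open>b / r\<close> with \<open>r \<le> sqrt M\<close>
  (Dirichlet) and classify the fractions by \<open>m = a r - b q\<^sup>2\<close>. At most one of them has
  \<open>m = 0\<close>. For fixed \<open>m \<noteq> 0\<close> any two solutions satisfy \<open>r dvd (q - q') (q + q')\<close>, so a
  factorisation \<open>r = r\<^sub>1 r\<^sub>2\<close> determines \<open>q\<close> modulo \<open>r / h\<close> with \<open>h = gcd r\<^sub>1 r\<^sub>2\<close>; and
  \<open>h\<^sup>2 dvd 4 m\<close>, so the classes with large \<open>h\<close> occur for few \<open>m\<close>. With the divisor bound
  this gives \<open>K \<le> 1 + O(M\<^sup>\<epsilon> Q\<^sup>2 / sqrt M)\<close>.\<close>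

section \<open>The divisor bound\<close>

text \<open>A divisor of a product splits into divisors of the two factors, and those of
  \<open>p ^ a\<close> are the \<open>a + 1\<close> powers \<open>p ^ i\<close>; so the pairs
  \<open>(i, d)\<close> cover all divisors.\<close>

lemma card_divisors_prime_power_mult_le:
  fixes p a m :: nat
  assumes "prime p" "m > 0"
  shows "card {d. d dvd p ^ a * m} \<le> (a + 1) * card {d. d dvd m}"
proof -
  have "{d. d dvd p ^ a * m} \<subseteq> (\<lambda>(i, d). p ^ i * d) ` ({..a} \<times> {d. d dvd m})"
  proof
    fix d assume "d \<in> {d. d dvd p ^ a * m}"
    then obtain x y where "d = x * y" "x dvd p ^ a" "y dvd m"
      using division_decomp by blast
    moreover from this obtain i where "i \<le> a" "x = p ^ i"
      using assms(1) divides_primepow_nat by blast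
    ultimately show "d \<in> (\<lambda>(i, d). p ^ i * d) ` ({..a} \<times> {d. d dvd m})"
      by force
  qed
  then have "card {d. d dvd p ^ a * m} \<le> card ({..a} \<times> {d. d dvd m})"
    using assms(2) by (intro surj_card_le) auto
  then show ?thesis by (simp add: card_cartesian_product)
qed

text \<open>The primes of \<open>S\<close> are split off one at a time, and the local inequality
  absorbs the factor \<open>a + 1\<close> that each costs. A prime of \<open>S\<close> not dividing
  \<open>n\<close> is the case \<open>a = 0\<close>, where the local inequality reads
  \<open>1 \<le> c p\<close>.\<close>

lemma card_divisors_le_prod:
  fixes c :: "nat \<Rightarrow> real" and \<epsilon> :: real
  assumes "finite S"
    and "\<And>p. p \<in> S \<Longrightarrow> prime p"
    and "\<And>p a. p \<in> S \<Longrightarrow> real a + 1 \<le> c p * real (p ^ a) powr \<epsilon>"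
    and "n > 0" "prime_factors n \<subseteq> S"
  shows "real (card {d. d dvd n}) \<le> (\<Prod>p\<in>S. c p) * real n powr \<epsilon>"
  using assms
proof (induction S arbitrary: n rule: finite_induct)
  case empty
  then have "n = 1"
    by (auto simp: prime_factorization_empty_iff)
  then show ?case by simp
next
  case (insert p S)
  have p: "prime p" using insert.prems(1) by simp
  define a where "a = multiplicity p n"
  obtain m where m: "n = p ^ a * m" "\<not> p dvd m"
    using multiplicity_decompose'[of n p] insert.prems(3) p
    by (metis a_def not_gr0 not_prime_unit)
  have m0: "m > 0" using m insert.prems(3) by (cases m) auto
  have "prime_factors m \<subseteq> S"
  proof
    fix x assume x: "x \<in> prime_factors m"
    then have "x \<in> prime_factors n"
      using m(1) insert.prems(3) by (auto simp: prime_factors_dvd)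
    moreover have "x \<noteq> p" using x m(2) by auto
    ultimately show "x \<in> S" using insert.prems(4) by auto
  qed
  then have IH: "real (card {d. d dvd m}) \<le> (\<Prod>p\<in>S. c p) * real m powr \<epsilon>"
    using insert.IH[of m] insert.prems m0 by simp
  have "real (card {d. d dvd n}) \<le> real ((a + 1) * card {d. d dvd m})"
    using card_divisors_prime_power_mult_le[OF p m0, of a] m(1) by (intro of_nat_mono) simp
  also have "\<dots> = (real a + 1) * real (card {d. d dvd m})" by (simp add: algebra_simps)
  also have "\<dots> \<le> (c p * real (p ^ a) powr \<epsilon>) * ((\<Prod>p\<in>S. c p) * real m powr \<epsilon>)"
    using IH insert.prems(2)[of p a] by (intro mult_mono) auto
  also have "\<dots> = (\<Prod>p\<in>insert p S. c p) * real n powr \<epsilon>"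
    using insert.hyps m(1) by (simp add: powr_mult)
  finally show ?case .
qed

text \<open>If \<open>p powr \<epsilon> \<ge> 2\<close>, then \<open>a + 1 \<le> 2 ^ a\<close> makes
  the local constant 1. Only the finitely many smaller primes cost a factor, at most
  \<open>C0\<close> each, so the total loss does not depend on \<open>n\<close>.\<close>

lemma card_divisors_bound:
  fixes \<epsilon> :: real
  assumes "\<epsilon> > 0"
  obtains C :: real where "C > 0" "\<And>n::nat. n > 0 \<Longrightarrow> real (card {d. d dvd n}) \<le> C * real n powr \<epsilon>"
proof -
  \<comment> \<open>With \<open>t = \<epsilon> * ln 2\<close> this is the choice for which
    \<open>C0 * (1 + a * t) = 1 + a + a * t + 1 / t\<close> exceeds \<open>a + 1\<close> for every
    \<open>a\<close>.\<close>
  define C0 where "C0 = 1 + 1 / (\<epsilon> * ln 2)"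
  have C0: "C0 \<ge> 1" using assms by (simp add: C0_def)
  define c :: "nat \<Rightarrow> real" where "c p = (if real p powr \<epsilon> \<ge> 2 then 1 else C0)" for p
  \<comment> \<open>Beyond this bound \<open>p powr \<epsilon> \<ge> 2\<close>, so
    \<open>c p = 1\<close>.\<close>
  define B where "B = nat \<lceil>2 powr (1 / \<epsilon>)\<rceil>"
  have c_bound: "real a + 1 \<le> c p * real (p ^ a) powr \<epsilon>" if "prime p" for p a
  proof -
    have p2: "p \<ge> 2" using that prime_ge_2_nat by blast
    have eq: "real (p ^ a) powr \<epsilon> = (real p powr \<epsilon>) ^ a"
      using p2 by (simp add: powr_powr powr_realpow[symmetric] mult.commute)
    show ?thesis
    proof (cases "real p powr \<epsilon> \<ge> 2")
      case True
      have "a < 2 ^ a" by simp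
      then have "real (a + 1) \<le> real (2 ^ a)" by (intro of_nat_mono) linarith
      then have "real a + 1 \<le> 2 ^ a" by simp
      also have "\<dots> \<le> (real p powr \<epsilon>) ^ a"
        using True by (intro power_mono) auto
      finally show ?thesis using True unfolding eq c_def by simp
    next
      case False
      have "1 + real a * (\<epsilon> * ln 2) \<le> exp (real a * (\<epsilon> * ln 2))"
        by (rule exp_ge_add_one_self)
      also have "\<dots> = (2 powr \<epsilon>) ^ a"
        by (simp add: powr_def exp_of_nat_mult)
      also have "\<dots> \<le> (real p powr \<epsilon>) ^ a"
        using p2 assms by (intro power_mono powr_mono2) auto
      finally have *: "1 + real a * (\<epsilon> * ln 2) \<le> (real p powr \<epsilon>) ^ a" .
      have pos: "\<epsilon> * ln 2 > 0" using assms by simp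
      have "C0 * (1 + real a * (\<epsilon> * ln 2))
          = 1 + real a + real a * (\<epsilon> * ln 2) + 1 / (\<epsilon> * ln 2)"
        using assms unfolding C0_def by (simp add: field_simps)
      then have "real a + 1 \<le> C0 * (1 + real a * (\<epsilon> * ln 2))"
        using pos by simp
      also have "\<dots> \<le> C0 * (real p powr \<epsilon>) ^ a"
        using * C0 by (intro mult_left_mono) auto
      finally show ?thesis using False unfolding eq c_def by simp
    qed
  qed
  have "real (card {d. d dvd n}) \<le> C0 ^ card {..B} * real n powr \<epsilon>" if "n > 0" for n :: nat
  proof -
    have "real (card {d. d dvd n}) \<le> (\<Prod>p\<in>prime_factors n. c p) * real n powr \<epsilon>"
      using c_bound that by (intro card_divisors_le_prod) auto
    also have "(\<Prod>p\<in>prime_factors n. c p) = (\<Prod>p\<in>prime_factors n \<inter> {..B}. c p)"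
    proof (rule prod.mono_neutral_right)
      show "\<forall>i\<in>prime_factors n - prime_factors n \<inter> {..B}. c i = 1"
      proof
        fix p assume "p \<in> prime_factors n - prime_factors n \<inter> {..B}"
        then have "p > B" by auto
        then have "2 powr (1 / \<epsilon>) \<le> real p"
          unfolding B_def by linarith
        then have "(2 powr (1 / \<epsilon>)) powr \<epsilon> \<le> real p powr \<epsilon>"
          using assms by (intro powr_mono2) auto
        then show "c p = 1" using assms by (simp add: c_def powr_powr)
      qed
    qed auto
    also have "\<dots> \<le> (\<Prod>p\<in>prime_factors n \<inter> {..B}. C0)"
      using C0 by (intro prod_mono) (auto simp: c_def)
    also have "\<dots> \<le> C0 ^ card {..B}"
      using C0 by (simp only: prod_constant) (intro power_increasing card_mono, auto)
    finally show ?thesis by (simp add: mult_right_mono)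
  qed
  then show thesis using that[of "C0 ^ card {..B}"] C0 by simp
qed

section \<open>Quadratic congruences\<close>

lemma card_residue_class_le:
  fixes A :: "int set" and k :: int and L :: real
  assumes "finite A" "k > 0" "L \<ge> 0"
    and "\<And>x y. x \<in> A \<Longrightarrow> y \<in> A \<Longrightarrow> k dvd x - y"
    and "\<And>x y. x \<in> A \<Longrightarrow> y \<in> A \<Longrightarrow> real_of_int \<bar>x - y\<bar> \<le> L"
  shows "real (card A) \<le> 1 + L / real_of_int k"
proof (cases "A = {}")
  case True
  then show ?thesis using assms by simp
next
  case False
  \<comment> \<open>Measured from the least element, every element is \<open>l + k * j\<close> with
    \<open>0 \<le> j \<le> L / k\<close>.\<close>
  define l where "l = Min A"
  have l: "l \<in> A" "\<And>x. x \<in> A \<Longrightarrow> l \<le> x"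
    using assms(1) False by (auto simp: l_def)
  have "A \<subseteq> (\<lambda>j. l + k * j) ` {0..\<lfloor>L / k\<rfloor>}"
  proof
    fix x assume x: "x \<in> A"
    obtain j where j: "x - l = k * j" using assms(4)[OF x l(1)] by blast
    have "k * j \<ge> 0" using l(2)[OF x] j by simp
    then have j0: "j \<ge> 0" using assms(2) by (simp add: zero_le_mult_iff)
    have "real_of_int (k * j) \<le> L" using assms(5)[OF x l(1)] j \<open>k * j \<ge> 0\<close> by simp
    then have "real_of_int j \<le> L / k" using assms(2) by (simp add: field_simps)
    then have "j \<le> \<lfloor>L / k\<rfloor>" by linarith
    then show "x \<in> (\<lambda>j. l + k * j) ` {0..\<lfloor>L / k\<rfloor>}"
      using j j0 by (intro image_eqI[of _ _ j]) auto
  qed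
  then have "card A \<le> card {0..\<lfloor>L / k\<rfloor>}" by (intro surj_card_le) auto
  also have "\<dots> = nat (\<lfloor>L / k\<rfloor> + 1)" by simp
  finally have "real (card A) \<le> real (nat (\<lfloor>L / k\<rfloor> + 1))" by simp
  moreover have "L / k \<ge> 0" using assms(2,3) by simp
  ultimately show ?thesis by linarith
qed

lemma finite_abs_int_le: "finite {m::int. P m \<and> real_of_int \<bar>m\<bar> \<le> X}"
proof (rule finite_subset)
  show "{m::int. P m \<and> real_of_int \<bar>m\<bar> \<le> X} \<subseteq> {-\<lfloor>X\<rfloor>..\<lfloor>X\<rfloor>}"
    by (auto simp: le_floor_iff abs_le_iff) linarith
qed simp

lemma card_nonzero_abs_int_le:
  fixes X :: real
  assumes "X \<ge> 0"
  shows "real (card {m::int. m \<noteq> 0 \<and> real_of_int \<bar>m\<bar> \<le> X}) \<le> 2 * X"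
proof -
  have "{m::int. m \<noteq> 0 \<and> real_of_int \<bar>m\<bar> \<le> X} \<subseteq> {-\<lfloor>X\<rfloor>..-1} \<union> {1..\<lfloor>X\<rfloor>}"
    by (auto simp: le_floor_iff) linarith+
  then have "card {m::int. m \<noteq> 0 \<and> real_of_int \<bar>m\<bar> \<le> X} \<le> card ({-\<lfloor>X\<rfloor>..-1} \<union> {1..\<lfloor>X\<rfloor>})"
    by (intro card_mono) auto
  also have "\<dots> \<le> card {-\<lfloor>X\<rfloor>..-1} + card {1..\<lfloor>X\<rfloor>}" by (rule card_Un_le)
  also have "\<dots> = 2 * nat \<lfloor>X\<rfloor>" by simp
  finally have "real (card {m::int. m \<noteq> 0 \<and> real_of_int \<bar>m\<bar> \<le> X}) \<le> real (2 * nat \<lfloor>X\<rfloor>)"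
    by (rule of_nat_mono)
  then show ?thesis using assms by linarith
qed

text \<open>The map \<open>m \<mapsto> 4 * m div g\<close> is injective into the nonzero integers up
  to \<open>4 * X / g\<close>. The factor 4 is there because the gcd argument below yields a divisor
  of \<open>4 * m\<close>.\<close>

lemma card_multiples_le:
  fixes X :: real and g :: int
  assumes "X \<ge> 0" "g > 0"
  shows "real (card {m::int. m \<noteq> 0 \<and> real_of_int \<bar>m\<bar> \<le> X \<and> g dvd 4 * m}) \<le> 8 * X / real_of_int g"
proof -
  let ?A = "{m::int. m \<noteq> 0 \<and> real_of_int \<bar>m\<bar> \<le> X \<and> g dvd 4 * m}"
  let ?B = "{m::int. m \<noteq> 0 \<and> real_of_int \<bar>m\<bar> \<le> 4 * X / g}"
  have "card ?A \<le> card ?B"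
  proof (rule card_inj_on_le)
    show "inj_on (\<lambda>m. 4 * m div g) ?A"
      using assms(2) by (auto simp: inj_on_def dvd_def)
    show "(\<lambda>m. 4 * m div g) ` ?A \<subseteq> ?B"
    proof (rule image_subsetI)
      fix m assume m: "m \<in> ?A"
      then obtain j where j: "4 * m = g * j" by auto
      have "real_of_int \<bar>g * j\<bar> = 4 * real_of_int \<bar>m\<bar>" using j[symmetric] by simp
      then have "real_of_int g * \<bar>j\<bar> \<le> 4 * X" using m assms(2) by (simp add: abs_mult)
      then have "real_of_int \<bar>j\<bar> \<le> 4 * X / g" using assms(2) by (simp add: field_simps)
      moreover have "j \<noteq> 0" using j m by auto
      ultimately show "4 * m div g \<in> ?B" using j assms(2) by simp
    qed
  qed (rule finite_abs_int_le)
  moreover have "real (card ?B) \<le> 2 * (4 * X / g)"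
    using assms by (intro card_nonzero_abs_int_le) auto
  ultimately show ?thesis by simp
qed

text \<open>For fixed \<open>m\<close> the two divisibilities determine \<open>q\<close> modulo
  \<open>lcm r1 r2 = r / h\<close>, where \<open>h = gcd r1 r2\<close>. The loss of \<open>h\<close>
  in the modulus is repaid by the rarity of \<open>m\<close>: only \<open>m\<close> with
  \<open>h\<^sup>2 dvd 4 * m\<close> occur.\<close>

lemma card_quadratic_congruence_class_le:
  fixes G :: "(int \<times> int) set" and b r r1 r2 :: int and c :: "int \<Rightarrow> int" and X L :: real
  assumes "finite G" "r1 > 0" "r2 > 0" "r = r1 * r2" "X \<ge> 0" "L \<ge> 0"
    and base: "\<And>q m. (q, m) \<in> G \<Longrightarrow> r dvd m + b * (c m)\<^sup>2"
    and G: "\<And>q m. (q, m) \<in> G \<Longrightarrow> r1 dvd q - c m \<and> r2 dvd q + c m"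
    and m: "\<And>q m. (q, m) \<in> G \<Longrightarrow> m \<noteq> 0 \<and> real_of_int \<bar>m\<bar> \<le> X"
    and near: "\<And>q q' m. (q, m) \<in> G \<Longrightarrow> (q', m) \<in> G \<Longrightarrow> real_of_int \<bar>q - q'\<bar> \<le> L"
  shows "real (card G) \<le> 8 * (X + X * L / real_of_int r)"
proof -
  define h where "h = gcd r1 r2"
  have h: "h \<ge> 1" using assms(2) by (simp add: h_def int_one_le_iff_zero_less)
  have r: "r > 0" using assms by simp
  have lcm: "h * lcm r1 r2 = r" using assms(2-4) unfolding h_def by (simp flip: prod_gcd_lcm_int)
  have lcm_pos: "lcm r1 r2 > 0" using assms(2,3) by (simp add: lcm_pos_int)
  have lcm_eq: "real_of_int (lcm r1 r2) = r / h" using lcm h by (simp add: field_simps flip: of_int_mult)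
  \<comment> \<open>Subtracting the two divisibilities gives \<open>h dvd 2 * c m\<close>, and
    \<open>h\<^sup>2\<close> divides \<open>r1 * r2 = r\<close>. Removing
    \<open>b * (2 * c m)\<^sup>2\<close> from \<open>4 * (m + b * (c m)\<^sup>2)\<close> leaves
    \<open>4 * m\<close>.\<close>
  have sq_dvd: "h\<^sup>2 dvd 4 * m" if "(q, m) \<in> G" for q m
  proof -
    have "h dvd q - c m" "h dvd q + c m"
      using G[OF that] by (auto simp: h_def intro: dvd_trans[OF gcd_dvd1] dvd_trans[OF gcd_dvd2])
    then have "h dvd (q + c m) - (q - c m)" by (rule dvd_diff[rotated])
    then have "h dvd 2 * c m" by simp
    then have "h\<^sup>2 dvd (2 * c m)\<^sup>2" by (rule dvd_power_same)
    then have 1: "h\<^sup>2 dvd b * (2 * c m)\<^sup>2" by simp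
    have "h\<^sup>2 dvd r" unfolding assms(4) power2_eq_square h_def by (intro mult_dvd_mono) auto
    then have "h\<^sup>2 dvd 4 * (m + b * (c m)\<^sup>2)" using base[OF that] by (meson dvd_mult dvd_trans)
    then have "h\<^sup>2 dvd 4 * (m + b * (c m)\<^sup>2) - b * (2 * c m)\<^sup>2" using 1 by (rule dvd_diff)
    then show ?thesis by (simp add: algebra_simps power2_eq_square)
  qed
  define fib where "fib m = {q. (q, m) \<in> G}" for m
  have fin_fib: "finite (fib m)" for m
    by (rule finite_subset[of _ "fst ` G"]) (use assms(1) in \<open>force simp: fib_def\<close>)+
  have fib_le: "real (card (fib m)) \<le> 1 + L / real_of_int (lcm r1 r2)" for m
  proof (rule card_residue_class_le[OF fin_fib lcm_pos assms(6)])
    fix x y assume "x \<in> fib m" "y \<in> fib m"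
    then have xy: "(x, m) \<in> G" "(y, m) \<in> G" by (auto simp: fib_def)
    have "r1 dvd (x - c m) - (y - c m)" "r2 dvd (x + c m) - (y + c m)"
      using G[OF xy(1)] G[OF xy(2)] by (blast intro: dvd_diff)+
    then show "lcm r1 r2 dvd x - y" by simp
    show "real_of_int \<bar>x - y\<bar> \<le> L" using near xy by blast
  qed
  have "G = prod.swap ` (Sigma (snd ` G) fib)"
    by (force simp: fib_def)
  then have "card G \<le> card (Sigma (snd ` G) fib)"
    by (metis assms(1) card_image_le fin_fib finite_SigmaI finite_imageI)
  also have "\<dots> = (\<Sum>m\<in>snd ` G. card (fib m))"
    using assms(1) fin_fib by simp
  finally have "real (card G) \<le> (\<Sum>m\<in>snd ` G. real (card (fib m)))"
    by (metis of_nat_le_iff of_nat_sum)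
  also have "\<dots> \<le> real (card (snd ` G)) * (1 + L / real_of_int (lcm r1 r2))"
    using fib_le by (intro sum_bounded_above)
  also have "\<dots> \<le> (8 * X / real_of_int (h\<^sup>2)) * (1 + L / real_of_int (lcm r1 r2))"
  proof (rule mult_right_mono)
    have "card (snd ` G) \<le> card {m::int. m \<noteq> 0 \<and> real_of_int \<bar>m\<bar> \<le> X \<and> h\<^sup>2 dvd 4 * m}"
    proof (rule card_mono)
      show "finite {m::int. m \<noteq> 0 \<and> real_of_int \<bar>m\<bar> \<le> X \<and> h\<^sup>2 dvd 4 * m}"
        by (rule finite_subset[OF _ finite_abs_int_le[of "\<lambda>_. True" X]]) auto
    qed (use m sq_dvd in force)
    also have "real \<dots> \<le> 8 * X / real_of_int (h\<^sup>2)"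
      using h assms(5) by (intro card_multiples_le) auto
    finally show "real (card (snd ` G)) \<le> 8 * X / real_of_int (h\<^sup>2)" by simp
  qed (use assms(6) lcm_pos in auto)
  \<comment> \<open>The saving \<open>h\<^sup>2\<close> in the number of \<open>m\<close> outweighs
    the factor \<open>h\<close> lost in the fibres, so \<open>h = 1\<close> is the worst case for
    both terms.\<close>
  also have "\<dots> = 8 * (X / (real_of_int h)\<^sup>2 + X * L / r / h)"
    unfolding lcm_eq using h r by (simp add: field_simps power2_eq_square)
  also have "\<dots> \<le> 8 * (X + X * L / r)"
  proof -
    have "X / (real_of_int h)\<^sup>2 \<le> X / 1" using h assms(5) by (intro divide_left_mono) auto
    moreover have "X * L / r / h \<le> X * L / r / 1"
      using h assms(5,6) r by (intro divide_left_mono) auto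
    ultimately show ?thesis by simp
  qed
  finally show ?thesis .
qed

text \<open>Relative to one reference solution \<open>c m\<close> for each \<open>m\<close>,
  invertibility of \<open>b\<close> modulo \<open>r\<close> gives
  \<open>r dvd (q - c m) * (q + c m)\<close>. Splitting \<open>r\<close> between the two factors
  sorts the pairs into one class per divisor of \<open>r\<close>, hence the divisor count in the
  bound.\<close>

lemma card_quadratic_congruence_le:
  fixes F :: "(int \<times> int) set" and b :: int and r :: nat and X L :: real
  assumes "finite F" "r > 0" "coprime b (int r)" "X \<ge> 0" "L \<ge> 0"
    and cong: "\<And>q m. (q, m) \<in> F \<Longrightarrow> int r dvd m + b * q\<^sup>2"
    and m: "\<And>q m. (q, m) \<in> F \<Longrightarrow> m \<noteq> 0 \<and> real_of_int \<bar>m\<bar> \<le> X"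
    and near: "\<And>q q' m. (q, m) \<in> F \<Longrightarrow> (q', m) \<in> F \<Longrightarrow> real_of_int \<bar>q - q'\<bar> \<le> L"
  shows "real (card F) \<le> 8 * real (card {d. d dvd r}) * (X + X * L / real r)"
proof -
  \<comment> \<open>The choice matters only for those \<open>m\<close> that occur in
    \<open>F\<close>, where it is a genuine solution.\<close>
  define c where "c m = (SOME q. (q, m) \<in> F)" for m
  have c: "(c m, m) \<in> F" if "(q, m) \<in> F" for q m
    using that unfolding c_def by (rule someI)
  define G where "G d = {(q, m). (q, m) \<in> F \<and> int d dvd q - c m \<and> int (r div d) dvd q + c m}" for d
  have fin: "finite (G d)" for d
    using assms(1) by (rule finite_subset[rotated]) (auto simp: G_def)
  have "F \<subseteq> (\<Union>d\<in>{d. d dvd r}. G d)"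
  proof
    fix p assume "p \<in> F"
    then obtain q m where p: "p = (q, m)" "(q, m) \<in> F" by (cases p) auto
    have "int r dvd (m + b * q\<^sup>2) - (m + b * (c m)\<^sup>2)"
      using cong p(2) c by (intro dvd_diff) blast+
    then have "int r dvd b * ((q - c m) * (q + c m))"
      by (simp add: algebra_simps power2_eq_square)
    then have dv: "int r dvd (q - c m) * (q + c m)"
      using assms(3) by (simp add: coprime_dvd_mult_right_iff coprime_commute)
    \<comment> \<open>Taking the full gcd makes the cofactor \<open>r div d\<close> coprime to
      \<open>(q - c m) div d\<close>, which forces the cofactor to divide
      \<open>q + c m\<close>.\<close>
    define d where "d = nat (gcd (int r) (q - c m))"
    have d: "int d = gcd (int r) (q - c m)" by (simp add: d_def)
    have d0: "d > 0" using assms(2) d by (metis gcd_pos_int of_nat_0_less_iff of_nat_0_eq_iff less_numeral_extra(3))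
    have "d dvd r" using d by (metis gcd_dvd1 int_dvd_int_iff)
    then obtain s where s: "r = d * s" by blast
    have "coprime (int s) ((q - c m) div int d)"
    proof -
      have "coprime (int r div int d) ((q - c m) div int d)"
        unfolding d using assms(2) by (intro div_gcd_coprime) auto
      then show ?thesis using s d0 by simp
    qed
    moreover have "int s dvd ((q - c m) div int d) * (q + c m)"
    proof -
      have "int d dvd q - c m" using d by simp
      then obtain t where t: "q - c m = int d * t" by blast
      then show ?thesis using dv d0 s by simp
    qed
    ultimately have "int s dvd q + c m" by (simp add: coprime_dvd_mult_right_iff)
    moreover have "int d dvd q - c m" unfolding d by simp
    ultimately have "p \<in> G d" using p s d0 by (simp add: G_def)
    then show "p \<in> (\<Union>d\<in>{d. d dvd r}. G d)" using \<open>d dvd r\<close> by blast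
  qed
  then have "card F \<le> card (\<Union>d\<in>{d. d dvd r}. G d)"
    using fin assms(2) by (intro card_mono) auto
  also have "\<dots> \<le> (\<Sum>d\<in>{d. d dvd r}. card (G d))"
    using assms(2) by (intro card_UN_le) auto
  finally have "real (card F) \<le> (\<Sum>d\<in>{d. d dvd r}. real (card (G d)))"
    by (metis of_nat_le_iff of_nat_sum)
  also have "\<dots> \<le> real (card {d. d dvd r}) * (8 * (X + X * L / real r))"
  proof (rule sum_bounded_above)
    fix d assume "d \<in> {d. d dvd r}"
    then obtain s where s: "r = d * s" by auto
    then have pos: "d > 0" "s > 0" using assms(2) by auto
    have "real (card (G d)) \<le> 8 * (X + X * L / real_of_int (int r))"
    proof (rule card_quadratic_congruence_class_le[OF fin])
      show "int r = int d * int s" using s by simp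
      fix q m assume "(q, m) \<in> G d"
      then have qm: "(q, m) \<in> F" "int d dvd q - c m" "int s dvd q + c m"
        using s pos by (auto simp: G_def)
      show "int r dvd m + b * (c m)\<^sup>2" using cong c qm(1) by blast
      show "int d dvd q - c m \<and> int s dvd q + c m" using qm by blast
      show "m \<noteq> 0 \<and> real_of_int \<bar>m\<bar> \<le> X" using m qm(1) by blast
      fix q' assume "(q', m) \<in> G d"
      then show "real_of_int \<bar>q - q'\<bar> \<le> L" using near qm(1) by (auto simp: G_def)
    qed (use pos assms(4,5) in auto)
    then show "real (card (G d)) \<le> 8 * (X + X * L / real r)" by simp
  qed
  also have "\<dots> = 8 * real (card {d. d dvd r}) * (X + X * L / real r)"
    by (simp only: mult_ac)
  finally show ?thesis .
qed

section \<open>The large sieve\<close>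

lemma e_eq: "e x = exp (\<i> * of_real (2 * pi * x))"
  by (simp add: e_def mult_ac)

lemma e_0 [simp]: "e 0 = 1"
  by (simp add: e_def)

lemma e_add: "e (x + y) = e x * e y"
  by (simp add: e_def distrib_left exp_add)

lemma cnj_e: "cnj (e x) = e (- x)"
  by (simp add: e_def exp_cnj)

lemma cmod_e [simp]: "cmod (e x) = 1"
  unfolding e_eq by (rule norm_exp_i_times)

lemma e_power: "e x ^ n = e (real n * x)"
  by (simp add: e_def mult_ac flip: exp_of_nat_mult)

lemma e_eq_1_iff: "e x = 1 \<longleftrightarrow> x \<in> \<int>"
proof
  assume "e x = 1"
  then obtain n :: int where "2 * pi * x = of_int (2 * n) * pi"
    by (auto simp: e_eq exp_eq_1)
  then have "x = of_int n" by simp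
  then show "x \<in> \<int>" by simp
next
  assume "x \<in> \<int>"
  then obtain n :: int where "x = of_int n" by (auto elim: Ints_cases)
  then show "e x = 1" by (auto simp: e_eq exp_eq_1)
qed

lemma cmod_e_diff_le: "cmod (e x - e y) \<le> 2 * pi * \<bar>x - y\<bar>"
proof -
  have "e x - e y = e y * (e (x - y) - 1)"
    using e_add[of y "x - y"] by (simp add: algebra_simps)
  then have "cmod (e x - e y) = 2 * \<bar>sin (2 * pi * (x - y) / 2)\<bar>"
    by (simp only: norm_mult cmod_e e_eq[of "x - y"] dist_exp_i_1)
  also have "\<dots> \<le> 2 * \<bar>2 * pi * (x - y) / 2\<bar>"
    by (intro mult_left_mono abs_sin_x_le_abs_x) simp
  also have "\<dots> = 2 * pi * \<bar>x - y\<bar>"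
    by (simp add: abs_mult)
  finally show ?thesis .
qed

section \<open>Orthogonality and mean squares on the grid \<open>k / M\<close>\<close>

lemma sum_e_complete:
  fixes j :: int and M :: nat
  assumes "\<bar>j\<bar> < int M"
  shows "(\<Sum>k=1..M. e (of_int j * (real k / real M))) = (if j = 0 then of_nat M else 0)"
proof (cases "j = 0")
  case True
  then show ?thesis by simp
next
  case False
  have M: "M > 0" using assms by simp
  \<comment> \<open>The sum is geometric in an \<open>M\<close>-th root of unity, which differs from
    1 because \<open>0 < \<bar>j\<bar> < M\<close>.\<close>
  define w where "w = e (of_int j / real M)"
  have w1: "w \<noteq> 1"
  proof
    assume "w = 1"
    then obtain t :: int where "of_int j / real M = of_int t"
      unfolding w_def e_eq_1_iff by (auto elim: Ints_cases)
    then have "real_of_int j = real_of_int (t * int M)" using M by (simp add: field_simps)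
    then have "j = t * int M" by (simp only: of_int_eq_iff)
    then have "int M dvd j" by simp
    then show False using dvd_imp_le_int[OF False] assms by force
  qed
  have wM: "w ^ M = 1"
    using M by (simp add: w_def e_power e_eq_1_iff)
  have "(\<Sum>k=1..M. e (of_int j * (real k / real M))) = (\<Sum>k=1..M. w ^ k)"
    by (intro sum.cong) (auto simp: w_def e_power mult_ac)
  also have "\<dots> = (\<Sum>k<M. w ^ Suc k)"
    by (rule sum.reindex_bij_witness[of _ Suc "\<lambda>k. k - 1"]) auto
  also have "\<dots> = w * (\<Sum>k<M. w ^ k)" by (simp add: sum_distrib_left)
  also have "\<dots> = 0" using w1 wM by (simp add: sum_gp_strict geometric_sum)
  finally show ?thesis using False by simp
qed

text \<open>Frequencies in \<open>1..u\<close> with \<open>u \<le> M\<close> differ by less than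
  \<open>M\<close>, so only the diagonal of the expanded square survives. Lengths \<open>u\<close>
  below \<open>M\<close> are allowed because the partial sums from Abel summation need the same
  bound.\<close>

lemma parseval_grid:
  fixes a :: "nat \<Rightarrow> complex" and u M :: nat
  assumes "u \<le> M" "M > 0"
  shows "(\<Sum>k=1..M. (cmod (\<Sum>n=1..u. a n * e (real n * (real k / real M))))\<^sup>2)
       = real M * (\<Sum>n=1..u. (cmod (a n))\<^sup>2)"
proof -
  have "complex_of_real (\<Sum>k=1..M. (cmod (\<Sum>n=1..u. a n * e (real n * (real k / real M))))\<^sup>2)
      = (\<Sum>k=1..M. \<Sum>n=1..u. \<Sum>m=1..u. a n * cnj (a m) * e (of_int (int n - int m) * (real k / real M)))"
  proof (simp only: of_real_sum complex_norm_square, rule sum.cong[OF refl])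
    fix k
    show "(\<Sum>n=1..u. a n * e (real n * (real k / real M))) * cnj (\<Sum>n=1..u. a n * e (real n * (real k / real M)))
      = (\<Sum>n=1..u. \<Sum>m=1..u. a n * cnj (a m) * e (of_int (int n - int m) * (real k / real M)))"
    proof (simp only: cnj_sum sum_product, intro sum.cong refl)
      fix n m
      have "e (of_int (int n - int m) * (real k / real M))
          = e (real n * (real k / real M) + - (real m * (real k / real M)))"
        by (simp add: diff_divide_distrib algebra_simps)
      also have "\<dots> = e (real n * (real k / real M)) * cnj (e (real m * (real k / real M)))"
        by (simp only: e_add cnj_e)
      finally show "a n * e (real n * (real k / real M)) * cnj (a m * e (real m * (real k / real M)))
        = a n * cnj (a m) * e (of_int (int n - int m) * (real k / real M))"
        by simp
    qed
  qed
  also have "\<dots> = (\<Sum>n=1..u. \<Sum>k=1..M. \<Sum>m=1..u. a n * cnj (a m) * e (of_int (int n - int m) * (real k / real M)))"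
    by (rule sum.swap)
  also have "\<dots> = (\<Sum>n=1..u. \<Sum>m=1..u. \<Sum>k=1..M. a n * cnj (a m) * e (of_int (int n - int m) * (real k / real M)))"
    by (intro sum.cong refl sum.swap)
  also have "\<dots> = (\<Sum>n=1..u. \<Sum>m=1..u. if n = m then of_nat M * (a n * cnj (a n)) else 0)"
  proof (intro sum.cong refl)
    fix n m assume nm: "n \<in> {1..u}" "m \<in> {1..u}"
    have "(\<Sum>k=1..M. a n * cnj (a m) * e (of_int (int n - int m) * (real k / real M)))
        = a n * cnj (a m) * (if int n - int m = 0 then of_nat M else 0)"
      unfolding sum_distrib_left[symmetric]
      using nm assms by (subst sum_e_complete) auto
    then show "(\<Sum>k=1..M. a n * cnj (a m) * e (of_int (int n - int m) * (real k / real M)))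
        = (if n = m then of_nat M * (a n * cnj (a n)) else 0)"
      by simp
  qed
  also have "\<dots> = complex_of_real (real M * (\<Sum>n=1..u. (cmod (a n))\<^sup>2))"
    by (simp add: sum_distrib_left flip: complex_norm_square)
  finally show ?thesis by (simp only: of_real_eq_iff)
qed

section \<open>From grid points to arbitrary points\<close>

lemma abel_summation:
  fixes c v :: "nat \<Rightarrow> 'a :: comm_ring"
  shows "(\<Sum>n=1..M. c n * v n)
       = (\<Sum>n=1..M. c n) * v M - (\<Sum>u=1..<M. (\<Sum>n=1..u. c n) * (v (Suc u) - v u))"
proof (induction M)
  case 0
  then show ?case by simp
next
  case (Suc M)
  show ?case
  proof (cases "M = 0")
    case True
    then show ?thesis by simp
  next
    case False
    then show ?thesis using Suc by (simp add: algebra_simps)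
  qed
qed

text \<open>Writing \<open>e (n * \<alpha>)\<close> as \<open>e (n * \<beta>) * v n\<close>, the
  twist \<open>v\<close> moves by at most \<open>2 * pi / M \<le> 8 / M\<close> per step. Abel
  summation therefore leaves the full sum at \<open>\<beta>\<close> plus \<open>8 / M\<close> times
  the sum of the partial sums in absolute value.\<close>

lemma cmod_square_trig_sum_le_grid:
  fixes a :: "nat \<Rightarrow> complex" and \<alpha> \<beta> :: real and M :: nat
  assumes "\<bar>\<alpha> - \<beta>\<bar> \<le> 1 / real M" "M > 0"
  shows "(cmod (\<Sum>n=1..M. a n * e (real n * \<alpha>)))\<^sup>2
    \<le> 2 * (cmod (\<Sum>n=1..M. a n * e (real n * \<beta>)))\<^sup>2
      + 128 / real M * (\<Sum>u=1..<M. (cmod (\<Sum>n=1..u. a n * e (real n * \<beta>)))\<^sup>2)"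
proof -
  define C where "C u = (\<Sum>n=1..u. a n * e (real n * \<beta>))" for u
  define v where "v n = e (real n * (\<alpha> - \<beta>))" for n
  define T where "T = (\<Sum>u=1..<M. cmod (C u))"
  have diff: "cmod (v (Suc u) - v u) \<le> 8 / real M" for u
  proof -
    have "cmod (v (Suc u) - v u) \<le> 2 * pi * \<bar>real (Suc u) * (\<alpha> - \<beta>) - real u * (\<alpha> - \<beta>)\<bar>"
      unfolding v_def by (rule cmod_e_diff_le)
    also have "\<dots> = 2 * pi * \<bar>\<alpha> - \<beta>\<bar>" by (simp add: algebra_simps)
    also have "\<dots> \<le> 2 * 4 * (1 / real M)"
      using assms pi_less_4 by (intro mult_mono) auto
    finally show ?thesis by simp
  qed
  have "(\<Sum>n=1..M. a n * e (real n * \<alpha>)) = (\<Sum>n=1..M. (a n * e (real n * \<beta>)) * v n)"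
    unfolding v_def mult.assoc by (simp add: algebra_simps flip: e_add)
  also have "\<dots> = C M * v M - (\<Sum>u=1..<M. C u * (v (Suc u) - v u))"
    unfolding C_def by (rule abel_summation)
  also have "cmod \<dots> \<le> cmod (C M * v M) + cmod (\<Sum>u=1..<M. C u * (v (Suc u) - v u))"
    by (rule norm_triangle_ineq4)
  also have "\<dots> \<le> cmod (C M) + (\<Sum>u=1..<M. cmod (C u) * (8 / real M))"
  proof (rule add_mono)
    show "cmod (\<Sum>u=1..<M. C u * (v (Suc u) - v u)) \<le> (\<Sum>u=1..<M. cmod (C u) * (8 / real M))"
      by (intro sum_norm_le) (simp only: norm_mult diff mult_left_mono norm_ge_zero)
  qed (simp add: norm_mult v_def)
  also have "\<dots> = cmod (C M) + T * (8 / real M)" by (simp only: T_def sum_distrib_right)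
  finally have "(cmod (\<Sum>n=1..M. a n * e (real n * \<alpha>)))\<^sup>2 \<le> (cmod (C M) + T * (8 / real M))\<^sup>2"
    by (intro power_mono) auto
  also have "\<dots> \<le> 2 * (cmod (C M))\<^sup>2 + 2 * (T * (8 / real M))\<^sup>2"
    using zero_le_power2[of "cmod (C M) - T * (8 / real M)"] unfolding power2_sum power2_diff by linarith
  also have "(T * (8 / real M))\<^sup>2 = T\<^sup>2 * (64 / (real M)\<^sup>2)"
    by (simp add: power_mult_distrib power_divide)
  \<comment> \<open>Cauchy-Schwarz costs a factor \<open>M\<close>, which turns
    \<open>2 * 64 / M\<^sup>2\<close> into the stated \<open>128 / M\<close>.\<close>
  also have "T\<^sup>2 \<le> (\<Sum>u=1..<M. (cmod (C u))\<^sup>2) * real M"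
  proof -
    have "T\<^sup>2 \<le> (\<Sum>u=1..<M. (cmod (C u))\<^sup>2) * real (card {1..<M})"
      unfolding T_def by (rule sum_squared_le_sum_of_squares)
    also have "\<dots> \<le> (\<Sum>u=1..<M. (cmod (C u))\<^sup>2) * real M"
      by (intro mult_left_mono sum_nonneg) auto
    finally show ?thesis .
  qed
  finally show ?thesis
    using assms(2) by (simp add: C_def field_simps power2_eq_square)
qed

text \<open>Every point is moved to a nearby grid point, at the cost of replacing its term by
  \<open>B k\<close>. A grid point receives at most \<open>K\<close> points, so the total is at most
  \<open>K\<close> times the sum of \<open>B\<close> over the whole grid, which Parseval
  evaluates.\<close>

lemma large_sieve:
  fixes \<alpha> :: "'i \<Rightarrow> real" and a :: "nat \<Rightarrow> complex" and M :: nat and K :: real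
  assumes "finite I" "M > 0" "\<And>i. i \<in> I \<Longrightarrow> 0 < \<alpha> i \<and> \<alpha> i \<le> 1"
    and K: "\<And>\<beta>. real (card {i\<in>I. \<beta> - 1 / real M < \<alpha> i \<and> \<alpha> i \<le> \<beta>}) \<le> K"
  shows "(\<Sum>i\<in>I. (cmod (\<Sum>n=1..M. a n * e (real n * \<alpha> i)))\<^sup>2)
    \<le> 130 * K * real M * (\<Sum>n=1..M. (cmod (a n))\<^sup>2)"
proof -
  define C where "C u k = (\<Sum>n=1..u. a n * e (real n * (real k / real M)))" for u k :: nat
  define B where "B k = 2 * (cmod (C M k))\<^sup>2 + 128 / real M * (\<Sum>u=1..<M. (cmod (C u k))\<^sup>2)" for k
  define Z where "Z = (\<Sum>n=1..M. (cmod (a n))\<^sup>2)"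
  \<comment> \<open>Rounding up sends \<open>0 < \<alpha> i \<le> 1\<close> to an index in
    \<open>1..M\<close>, and points with the same index \<open>k\<close> share the window from
    \<open>(k - 1) / M\<close> (excluded) to \<open>k / M\<close> (included).\<close>
  define \<kappa> where "\<kappa> i = nat \<lceil>real M * \<alpha> i\<rceil>" for i
  have B0: "B k \<ge> 0" for k unfolding B_def by (intro add_nonneg_nonneg mult_nonneg_nonneg sum_nonneg) auto
  have K0: "K \<ge> 0" using K[of 0] by linarith
  have \<kappa>: "real (\<kappa> i) / real M - 1 / real M < \<alpha> i" "\<alpha> i \<le> real (\<kappa> i) / real M" "\<kappa> i \<in> {1..M}"
    if "i \<in> I" for i
  proof -
    have pos: "0 < real M * \<alpha> i" "real M * \<alpha> i \<le> real M" using assms(2) assms(3)[OF that] by auto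
    then have 1: "real (\<kappa> i) = of_int \<lceil>real M * \<alpha> i\<rceil>" by (simp add: \<kappa>_def)
    then have 2: "real (\<kappa> i) < real M * \<alpha> i + 1" "real M * \<alpha> i \<le> real (\<kappa> i)" by linarith+
    then show "real (\<kappa> i) / real M - 1 / real M < \<alpha> i" "\<alpha> i \<le> real (\<kappa> i) / real M"
      using assms(2) by (auto simp: field_simps)
    have "real (\<kappa> i) > 0" using 2 pos by linarith
    moreover have "\<lceil>real M * \<alpha> i\<rceil> \<le> int M" using pos by (simp only: ceiling_le_iff of_int_of_nat_eq)
    then have "\<kappa> i \<le> M" unfolding \<kappa>_def by linarith
    ultimately show "\<kappa> i \<in> {1..M}" by simp
  qed
  have "(\<Sum>i\<in>I. (cmod (\<Sum>n=1..M. a n * e (real n * \<alpha> i)))\<^sup>2) \<le> (\<Sum>i\<in>I. B (\<kappa> i))"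
  proof (rule sum_mono)
    fix i assume "i \<in> I"
    then have "\<bar>\<alpha> i - real (\<kappa> i) / real M\<bar> \<le> 1 / real M" using \<kappa>[of i] by linarith
    from cmod_square_trig_sum_le_grid[OF this assms(2), of a]
    show "(cmod (\<Sum>n=1..M. a n * e (real n * \<alpha> i)))\<^sup>2 \<le> B (\<kappa> i)"
      unfolding B_def C_def .
  qed
  also have "\<dots> = (\<Sum>k=1..M. \<Sum>i\<in>{i\<in>I. \<kappa> i = k}. B (\<kappa> i))"
    using assms(1) \<kappa>(3) by (intro sum.group[symmetric]) auto
  also have "\<dots> \<le> (\<Sum>k=1..M. K * B k)"
  proof (rule sum_mono)
    fix k assume "k \<in> {1..M}"
    have "(\<Sum>i\<in>{i\<in>I. \<kappa> i = k}. B (\<kappa> i)) = real (card {i\<in>I. \<kappa> i = k}) * B k" by simp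
    also have "card {i\<in>I. \<kappa> i = k}
        \<le> card {i\<in>I. real k / real M - 1 / real M < \<alpha> i \<and> \<alpha> i \<le> real k / real M}"
      using assms(1) \<kappa> by (intro card_mono) auto
    also have "real \<dots> \<le> K" by (rule K)
    finally show "(\<Sum>i\<in>{i\<in>I. \<kappa> i = k}. B (\<kappa> i)) \<le> K * B k"
      using B0 by (simp add: mult_right_mono)
  qed
  also have "\<dots> = K * (2 * (\<Sum>k=1..M. (cmod (C M k))\<^sup>2)
      + 128 / real M * (\<Sum>u=1..<M. \<Sum>k=1..M. (cmod (C u k))\<^sup>2))"
    unfolding B_def by (subst sum.swap) (simp only: sum_distrib_left[symmetric] sum.distrib)
  also have "\<dots> \<le> K * (2 * (real M * Z) + 128 / real M * (real M * (real M * Z)))"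
  proof (intro mult_left_mono add_mono K0)
    show "(\<Sum>k=1..M. (cmod (C M k))\<^sup>2) \<le> real M * Z"
      unfolding C_def Z_def using assms(2) by (subst parseval_grid) auto
    \<comment> \<open>Fewer than \<open>M\<close> lengths contribute at most \<open>M * Z\<close>
      each. The weight \<open>128 / M\<close> cancels one factor \<open>M\<close>, and the constants
      add up to \<open>2 + 128 = 130\<close>.\<close>
    have "(\<Sum>u=1..<M. \<Sum>k=1..M. (cmod (C u k))\<^sup>2) \<le> (\<Sum>u=1..<M. real M * Z)"
    proof (rule sum_mono)
      fix u assume "u \<in> {1..<M}"
      then show "(\<Sum>k=1..M. (cmod (C u k))\<^sup>2) \<le> real M * Z"
        unfolding C_def Z_def by (subst parseval_grid) (auto intro!: mult_left_mono sum_mono2)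
    qed
    also have "\<dots> \<le> real M * (real M * Z)"
      by (simp add: Z_def mult_right_mono sum_nonneg)
    finally show "(\<Sum>u=1..<M. \<Sum>k=1..M. (cmod (C u k))\<^sup>2) \<le> real M * (real M * Z)" .
  qed auto
  also have "\<dots> = 130 * K * real M * Z" using assms(2) by (simp add: field_simps)
  finally show ?thesis unfolding Z_def .
qed

section \<open>Fractions with square denominator in short intervals\<close>

text \<open>In lowest terms the denominators \<open>q\<^sup>2\<close> and \<open>q'\<^sup>2\<close>
  of equal fractions divide each other.\<close>

lemma square_fraction_unique:
  fixes q a q' a' :: nat
  assumes "q > 0" "q' > 0" "coprime a q" "coprime a' q'" "a * q'\<^sup>2 = a' * q\<^sup>2"
  shows "q = q' \<and> a = a'"
proof -
  have "coprime (q\<^sup>2) a" "coprime (q'\<^sup>2) a'"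
    using assms(3,4) by (auto simp: coprime_commute)
  moreover have "q\<^sup>2 dvd a * q'\<^sup>2" "q'\<^sup>2 dvd a' * q\<^sup>2"
    by (metis assms(5) dvd_triv_right)+
  ultimately have "q\<^sup>2 dvd q'\<^sup>2" "q'\<^sup>2 dvd q\<^sup>2"
    by (simp_all add: coprime_dvd_mult_right_iff)
  then have "q\<^sup>2 = q'\<^sup>2" by (rule dvd_antisym)
  then show ?thesis using assms by simp
qed

text \<open>The window is open on the left and closed on the right to match the rounding up to the
  grid in \<open>large_sieve\<close>.\<close>

definition in_window :: "real \<Rightarrow> nat \<Rightarrow> nat \<Rightarrow> nat \<Rightarrow> nat \<Rightarrow> bool" where
  "in_window \<beta> M Q q a \<longleftrightarrow> q > 0 \<and> q \<le> Q \<and>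
     \<beta> - 1 / real M < real a / real (q\<^sup>2) \<and> real a / real (q\<^sup>2) \<le> \<beta>"

text \<open>If \<open>z\<close> is of order \<open>1 / M\<close>, the trivial bound \<open>Q\<close> for the spread of \<open>q\<close> suffices; otherwise
  the numerator \<open>a * r - b * q\<^sup>2\<close> pins \<open>q\<close> down to a window of relative length \<open>1 / (M * \<bar>z\<bar>)\<close>.\<close>

lemma window_numerators:
  fixes \<beta> :: real and b :: int and r M Q :: nat and z :: real
  assumes "r > 0" "M > 0" "Q\<^sup>2 \<le> M" "r\<^sup>2 \<le> M"
    and z: "z = \<beta> - real_of_int b / real r" "\<bar>z\<bar> * real r \<le> 2 / sqrt (real M)"
  obtains X L :: real where "X \<ge> 0" "L \<ge> 0" "X + X * L / real r \<le> 8 * (real Q)\<^sup>2 / sqrt (real M)"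
    "\<And>q a::nat. in_window \<beta> M Q q a \<Longrightarrow>
       \<bar>real_of_int (int a * int r - b * (int q)\<^sup>2)\<bar> \<le> X"
    "\<And>q a q' a'::nat. in_window \<beta> M Q q a \<Longrightarrow>
       in_window \<beta> M Q q' a' \<Longrightarrow>
       int a * int r - b * (int q)\<^sup>2 = int a' * int r - b * (int q')\<^sup>2 \<Longrightarrow> q \<le> q' \<Longrightarrow>
       real q' - real q \<le> L"
proof -
  define D where "D = 1 / real M"
  have D0: "D > 0" using assms(2) by (simp add: D_def)
  have D_sqrt: "D = 1 / sqrt (real M) * (1 / sqrt (real M))" using assms(2) by (simp add: D_def)
  have sq_M: "sqrt (real M) > 0" using assms(2) by simp
  have le_sqrt: "real n \<le> sqrt (real M)" if "n\<^sup>2 \<le> M" for n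
    using that by (intro real_le_rsqrt) (metis of_nat_le_iff of_nat_power)
  \<comment> \<open>A factor of size at most \<open>sqrt M\<close> uses up half of
    \<open>D = (1 / sqrt M)\<^sup>2\<close>. It is applied with \<open>n = r\<close> and
    \<open>n = Q\<close>.\<close>
  have times_D: "real n * D \<le> 1 / sqrt (real M)" if "n\<^sup>2 \<le> M" for n
  proof -
    have "real n * D = real n / sqrt (real M) * (1 / sqrt (real M))" by (simp add: D_sqrt)
    also have "\<dots> \<le> 1 * (1 / sqrt (real M))"
      using le_sqrt[OF that] sq_M by (intro mult_right_mono) auto
    finally show ?thesis by simp
  qed
  define m where "m q a = real_of_int (int a * int r - b * (int q)\<^sup>2)" for q a :: nat
  \<comment> \<open>Up to the scale \<open>r * q\<^sup>2\<close>, the numerator is the distance from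
    \<open>b / r\<close>, which inside the window lies between \<open>z - D\<close> and
    \<open>z\<close>.\<close>
  have m_eq: "m q a = real r * (real q)\<^sup>2 * (real a / real (q\<^sup>2) - real_of_int b / real r)" if "q > 0" for q a
    using that assms(1) by (simp add: m_def field_simps power2_eq_square)
  have m_bounds: "real r * (real q)\<^sup>2 * (z - D) \<le> m q a" "m q a \<le> real r * (real q)\<^sup>2 * z"
    if "in_window \<beta> M Q q a" for q a
    using that m_eq[of q a] by (auto simp: in_window_def z(1) D_def intro!: mult_left_mono)
  have m_abs: "\<bar>m q a\<bar> \<le> real r * (real Q)\<^sup>2 * (\<bar>z\<bar> + D)"
    if "in_window \<beta> M Q q a" for q a
  proof -
    have "\<bar>m q a\<bar> = real r * (real q)\<^sup>2 * \<bar>real a / real (q\<^sup>2) - real_of_int b / real r\<bar>"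
      using that m_eq[of q a] by (simp add: in_window_def abs_mult)
    also have "\<dots> \<le> real r * (real Q)\<^sup>2 * (\<bar>z\<bar> + D)"
    proof (intro mult_mono)
      show "\<bar>real a / real (q\<^sup>2) - real_of_int b / real r\<bar> \<le> \<bar>z\<bar> + D"
        using that D0 unfolding in_window_def z(1) D_def by linarith
    qed (use that in \<open>auto simp: in_window_def\<close>)
    finally show ?thesis .
  qed
  show thesis
  proof (cases "\<bar>z\<bar> \<le> 2 * D")
    case True
    \<comment> \<open>In this case \<open>\<bar>z\<bar> + D \<le> 3 * D\<close>.\<close>
    define X where "X = 3 * real r * (real Q)\<^sup>2 * D"
    have "X = 3 * (real Q)\<^sup>2 * (real r * D)" by (simp add: X_def)
    also have "\<dots> \<le> 3 * (real Q)\<^sup>2 * (1 / sqrt (real M))"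
      using times_D[OF assms(4)] by (intro mult_left_mono) auto
    finally have X1: "X \<le> 3 * (real Q)\<^sup>2 / sqrt (real M)" by simp
    have "X * real Q / real r = 3 * (real Q)\<^sup>2 * (real Q * D)" using assms(1) by (simp add: X_def)
    also have "\<dots> \<le> 3 * (real Q)\<^sup>2 * (1 / sqrt (real M))"
      using times_D[OF assms(3)] by (intro mult_left_mono) auto
    finally have X2: "X * real Q / real r \<le> 3 * (real Q)\<^sup>2 / sqrt (real M)" by simp
    have nn: "(real Q)\<^sup>2 / sqrt (real M) \<ge> 0" by simp
    show thesis
    proof (rule that[of X "real Q"])
      show "X + X * real Q / real r \<le> 8 * (real Q)\<^sup>2 / sqrt (real M)"
        using X1 X2 nn by linarith
      fix q a :: nat
      assume *: "in_window \<beta> M Q q a"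
      have "\<bar>m q a\<bar> \<le> real r * (real Q)\<^sup>2 * (\<bar>z\<bar> + D)" by (rule m_abs[OF *])
      also have "\<dots> \<le> real r * (real Q)\<^sup>2 * (3 * D)"
        using True by (intro mult_left_mono) auto
      finally show "\<bar>real_of_int (int a * int r - b * (int q)\<^sup>2)\<bar> \<le> X" by (simp add: X_def m_def)
    qed (use D0 in \<open>auto simp: X_def in_window_def\<close>)
  next
    case False
    have z0: "\<bar>z\<bar> > 0" using False D0 by linarith
    \<comment> \<open>Here \<open>D < \<bar>z\<bar> / 2\<close>, so
      \<open>\<bar>z\<bar> + D \<le> 2 * \<bar>z\<bar>\<close>. The factor
      \<open>\<bar>z\<bar>\<close> cancels in \<open>X * L\<close>, and each of the two terms is at
      most half of the allowed 8.\<close>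
    define X where "X = 2 * real r * (real Q)\<^sup>2 * \<bar>z\<bar>"
    define L where "L = 2 * real Q * D / \<bar>z\<bar>"
    have "X = 2 * (real Q)\<^sup>2 * (\<bar>z\<bar> * real r)" by (simp add: X_def)
    also have "\<dots> \<le> 2 * (real Q)\<^sup>2 * (2 / sqrt (real M))"
      using z(2) by (intro mult_left_mono) auto
    finally have X1: "X \<le> 4 * (real Q)\<^sup>2 / sqrt (real M)" by simp
    have "X * L / real r = 4 * (real Q)\<^sup>2 * (real Q * D)" using assms(1) z0 by (simp add: X_def L_def)
    also have "\<dots> \<le> 4 * (real Q)\<^sup>2 * (1 / sqrt (real M))"
      using times_D[OF assms(3)] by (intro mult_left_mono) auto
    finally have X2: "X * L / real r \<le> 4 * (real Q)\<^sup>2 / sqrt (real M)" by simp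
    show thesis
    proof (rule that[of X L])
      show "X + X * L / real r \<le> 8 * (real Q)\<^sup>2 / sqrt (real M)"
        using X1 X2 by linarith
      fix q a :: nat
      assume *: "in_window \<beta> M Q q a"
      have "\<bar>m q a\<bar> \<le> real r * (real Q)\<^sup>2 * (\<bar>z\<bar> + D)" by (rule m_abs[OF *])
      also have "\<dots> \<le> real r * (real Q)\<^sup>2 * (2 * \<bar>z\<bar>)"
        using False D0 by (intro mult_left_mono) auto
      finally show "\<bar>real_of_int (int a * int r - b * (int q)\<^sup>2)\<bar> \<le> X" by (simp add: X_def m_def)
      fix q' a' :: nat
      assume **: "in_window \<beta> M Q q' a'"
        and same: "int a * int r - b * (int q)\<^sup>2 = int a' * int r - b * (int q')\<^sup>2" and le: "q \<le> q'"
      have same': "m q a = m q' a'" using same by (simp add: m_def)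
      define x where "x = real q"
      define y where "y = real q'"
      have xy: "0 < x" "x \<le> y" "y \<le> real Q" using * ** le by (auto simp: in_window_def x_def y_def)
      have r0: "real r > 0" using assms(1) by simp
      \<comment> \<open>Equal numerators let the lower bound at one of \<open>x\<close>,
        \<open>y\<close> be compared with the upper bound at the other; the sign of \<open>z\<close>
        decides which pairing is useful. For \<open>z > 0\<close> half of \<open>z\<close> is given
        up through \<open>z - D \<ge> z / 2\<close>.\<close>
      have "(y\<^sup>2 - x\<^sup>2) * (\<bar>z\<bar> / 2) \<le> x\<^sup>2 * D"
      proof (cases "z > 0")
        case True
        have "real r * y\<^sup>2 * (z - D) \<le> real r * x\<^sup>2 * z"
          using m_bounds(1)[OF **] m_bounds(2)[OF *] same' by (simp add: x_def y_def)
        then have "real r * (y\<^sup>2 * (z - D)) \<le> real r * (x\<^sup>2 * z)" by (simp only: mult.assoc)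
        then have "y\<^sup>2 * (z - D) \<le> x\<^sup>2 * z" using r0 by (simp only: mult_le_cancel_left_pos)
        then have "(y\<^sup>2 - x\<^sup>2) * (z - D) \<le> x\<^sup>2 * D" by (simp add: algebra_simps)
        moreover have "(y\<^sup>2 - x\<^sup>2) * (z / 2) \<le> (y\<^sup>2 - x\<^sup>2) * (z - D)"
          using False True xy by (intro mult_left_mono) (auto intro!: power_mono)
        ultimately show ?thesis using True by simp
      next
        case zneg: False
        have "real r * x\<^sup>2 * (z - D) \<le> real r * y\<^sup>2 * z"
          using m_bounds(2)[OF **] m_bounds(1)[OF *] same' by (simp add: x_def y_def)
        then have "real r * (x\<^sup>2 * (z - D)) \<le> real r * (y\<^sup>2 * z)" by (simp only: mult.assoc)
        then have "x\<^sup>2 * (z - D) \<le> y\<^sup>2 * z" using r0 by (simp only: mult_le_cancel_left_pos)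
        then have "(y\<^sup>2 - x\<^sup>2) * \<bar>z\<bar> \<le> x\<^sup>2 * D" using zneg by (simp add: algebra_simps)
        moreover have "(y\<^sup>2 - x\<^sup>2) * (\<bar>z\<bar> / 2) \<le> (y\<^sup>2 - x\<^sup>2) * \<bar>z\<bar>"
          using xy by (intro mult_left_mono) (auto intro!: power_mono)
        ultimately show ?thesis by linarith
      qed
      \<comment> \<open>Bounding \<open>y + x\<close> below by \<open>x\<close> makes the difference
        of squares linear in \<open>y - x\<close>, and one factor \<open>x\<close> then
        cancels.\<close>
      moreover have "x * ((y - x) * (\<bar>z\<bar> / 2)) \<le> (y\<^sup>2 - x\<^sup>2) * (\<bar>z\<bar> / 2)"
      proof -
        have "x * (y - x) \<le> (y + x) * (y - x)" using xy by (intro mult_right_mono) auto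
        then have "x * (y - x) \<le> y\<^sup>2 - x\<^sup>2" by (simp add: algebra_simps power2_eq_square)
        then have "x * (y - x) * (\<bar>z\<bar> / 2) \<le> (y\<^sup>2 - x\<^sup>2) * (\<bar>z\<bar> / 2)" by (intro mult_right_mono) auto
        then show ?thesis by (simp only: mult.assoc)
      qed
      ultimately have "x * ((y - x) * (\<bar>z\<bar> / 2)) \<le> x * (x * D)"
        by (simp add: power2_eq_square)
      then have "(y - x) * (\<bar>z\<bar> / 2) \<le> x * D" using xy(1) by (simp only: mult_le_cancel_left_pos)
      also have "\<dots> \<le> real Q * D" using xy D0 by (intro mult_right_mono) auto
      finally have "y - x \<le> L" using z0 by (simp add: L_def field_simps)
      then show "real q' - real q \<le> L" by (simp add: x_def y_def)
    qed (use D0 in \<open>auto simp: X_def L_def\<close>)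
  qed
qed

text \<open>Comparing with a Dirichlet approximation \<open>b / r\<close> of \<open>\<beta>\<close>
  turns a fraction into a pair \<open>(q, m)\<close> with \<open>m = a * r - b * q\<^sup>2\<close>,
  hence \<open>r dvd m + b * q\<^sup>2\<close>. The pairs with \<open>m \<noteq> 0\<close> fall
  under the congruence count, with \<open>64 = 8 * 8\<close>.\<close>

lemma card_square_fractions_le:
  fixes P :: "(nat \<times> nat) set" and \<beta> :: real and M Q :: nat
  assumes "finite P" "M > 0" "Q\<^sup>2 \<le> M"
    and P: "\<And>q a. (q, a) \<in> P \<Longrightarrow> in_window \<beta> M Q q a \<and> coprime a q"
  obtains r :: nat where "r > 0" "r\<^sup>2 \<le> M"
    "real (card P) \<le> 1 + 64 * real (card {d. d dvd r}) * (real Q)\<^sup>2 / sqrt (real M)"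
proof -
  have sq_M: "sqrt (real M) > 0" using assms(2) by simp
  \<comment> \<open>The integer part of \<open>sqrt M\<close> is at least half of it, so Dirichlet's
    error \<open>1 / n\<close> is at most \<open>2 / sqrt M\<close>, as
    \<open>window_numerators\<close> requires.\<close>
  define n where "n = nat \<lfloor>sqrt (real M)\<rfloor>"
  have sqrt1: "sqrt (real M) \<ge> 1" using assms(2) by simp
  then have fl: "\<lfloor>sqrt (real M)\<rfloor> \<ge> 1" by (simp only: le_floor_iff of_int_1)
  then have "real n = of_int \<lfloor>sqrt (real M)\<rfloor>" by (simp add: n_def)
  then have n: "n > 0" "real n \<le> sqrt (real M)" "sqrt (real M) \<le> 2 * real n"
    using fl by linarith+
  obtain b k where bk: "coprime b k" "0 < k" "k \<le> int n" "\<bar>of_int k * \<beta> - of_int b\<bar> < 1 / real n"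
    using Dirichlet_approx_coprime[OF n(1)] by blast
  define r where "r = nat k"
  have r: "r > 0" "k = int r" "r \<le> n" using bk by (auto simp: r_def)
  have "(real r)\<^sup>2 \<le> (sqrt (real M))\<^sup>2" using r(3) n(2) by (intro power_mono) auto
  then have rM: "r\<^sup>2 \<le> M" by (simp flip: of_nat_power)
  define z where "z = \<beta> - real_of_int b / real r"
  have "\<bar>z\<bar> * real r = \<bar>real r * \<beta> - of_int b\<bar>"
    using r(1) by (simp add: z_def field_simps flip: abs_mult_pos)
  also have "\<dots> \<le> 1 / real n" using bk(4) r(2) by simp
  also have "\<dots> \<le> 2 / sqrt (real M)" using n(1,3) sq_M by (simp add: divide_le_eq le_divide_eq field_simps del: real_sqrt_gt_0_iff)
  finally have z: "\<bar>z\<bar> * real r \<le> 2 / sqrt (real M)" .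
  obtain X L :: real where XL: "X \<ge> 0" "L \<ge> 0" "X + X * L / real r \<le> 8 * (real Q)\<^sup>2 / sqrt (real M)"
    and X: "\<And>q a::nat. in_window \<beta> M Q q a \<Longrightarrow>
       \<bar>real_of_int (int a * int r - b * (int q)\<^sup>2)\<bar> \<le> X"
    and L: "\<And>q a q' a'::nat. in_window \<beta> M Q q a \<Longrightarrow>
       in_window \<beta> M Q q' a' \<Longrightarrow>
       int a * int r - b * (int q)\<^sup>2 = int a' * int r - b * (int q')\<^sup>2 \<Longrightarrow> q \<le> q' \<Longrightarrow>
       real q' - real q \<le> L"
    using window_numerators[OF r(1) assms(2,3) rM z_def z] by metis
  define f where "f = (\<lambda>(q::nat, a::nat). (int q, int a * int r - b * (int q)\<^sup>2))"
  define P0 where "P0 = {p \<in> P. snd (f p) = 0}"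
  define P1 where "P1 = {p \<in> P. snd (f p) \<noteq> 0}"
  have fin: "finite P0" "finite P1" using assms(1) by (auto simp: P0_def P1_def)
  \<comment> \<open>A vanishing numerator means that the fraction equals \<open>b / r\<close>; two
    such fractions agree, and lowest terms make the pairs agree.\<close>
  have "card P0 \<le> 1"
  proof -
    have "p = p'" if pp: "p \<in> P0" "p' \<in> P0" for p p'
    proof -
      obtain q a q' a' where eq: "p = (q, a)" "p' = (q', a')" by (cases p, cases p')
      have in_P: "(q, a) \<in> P" "(q', a') \<in> P" using pp eq by (auto simp: P0_def)
      have 1: "int a * int r = b * (int q)\<^sup>2" "int a' * int r = b * (int q')\<^sup>2"
        using pp eq by (auto simp: P0_def f_def)
      have "int r * (int a * (int q')\<^sup>2) = (b * (int q)\<^sup>2) * (int q')\<^sup>2" by (simp flip: 1(1))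
      also have "\<dots> = int r * (int a' * (int q)\<^sup>2)" using 1(2) by (simp add: algebra_simps)
      finally have "int a * (int q')\<^sup>2 = int a' * (int q)\<^sup>2" using r(1) by simp
      then have "int (a * q'\<^sup>2) = int (a' * q\<^sup>2)" by simp
      then have "a * q'\<^sup>2 = a' * q\<^sup>2" by (simp only: of_nat_eq_iff)
      then show ?thesis using square_fraction_unique[of q q' a a'] P in_P eq unfolding in_window_def by blast
    qed
    then show ?thesis using fin(1) by (simp add: card_le_Suc0_iff_eq)
  qed
  moreover have "real (card P1) \<le> 64 * real (card {d. d dvd r}) * (real Q)\<^sup>2 / sqrt (real M)"
  proof -
    have "inj_on f P1" using r(1) by (auto simp: inj_on_def f_def)
    then have "real (card P1) = real (card (f ` P1))" by (simp add: card_image)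
    also have "\<dots> \<le> 8 * real (card {d. d dvd r}) * (X + X * L / real r)"
    proof (rule card_quadratic_congruence_le)
      show "coprime b (int r)" using bk(1) r(2) by simp
      fix q m assume "(q, m) \<in> f ` P1"
      then obtain q1 a1 where 1: "(q1, a1) \<in> P" "q = int q1" "m = int a1 * int r - b * (int q1)\<^sup>2" "m \<noteq> 0"
        by (auto simp: P1_def f_def)
      show "int r dvd m + b * q\<^sup>2" using 1 by simp
      show "m \<noteq> 0 \<and> real_of_int \<bar>m\<bar> \<le> X" using 1(4) X[of q1 a1] P[OF 1(1)] unfolding 1(3) by simp
      fix q' assume "(q', m) \<in> f ` P1"
      then obtain q2 a2 where 2: "(q2, a2) \<in> P" "q' = int q2" "m = int a2 * int r - b * (int q2)\<^sup>2"
        by (auto simp: P1_def f_def)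
      have "\<bar>real q1 - real q2\<bar> \<le> L"
      proof (cases "q1 \<le> q2")
        case True
        then show ?thesis using L[of q1 a1 q2 a2] P[OF 1(1)] P[OF 2(1)] 1(3) 2(3) by auto
      next
        case False
        then show ?thesis using L[of q2 a2 q1 a1] P[OF 1(1)] P[OF 2(1)] 1(3) 2(3) by auto
      qed
      then show "real_of_int \<bar>q - q'\<bar> \<le> L" using 1(2) 2(2) by simp
    qed (use fin r XL in auto)
    also have "\<dots> \<le> 8 * real (card {d. d dvd r}) * (8 * (real Q)\<^sup>2 / sqrt (real M))"
      using XL(3) by (intro mult_left_mono) auto
    finally show ?thesis by simp
  qed
  moreover have "card P \<le> card P0 + card P1"
  proof -
    have "P = P0 \<union> P1" by (auto simp: P0_def P1_def)
    then show ?thesis by (metis card_Un_le)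
  qed
  ultimately have "real (card P) \<le> 1 + 64 * real (card {d. d dvd r}) * (real Q)\<^sup>2 / sqrt (real M)"
    by linarith
  then show thesis using that r(1) rM by blast
qed

text \<open>For each \<open>q\<close> the numerators lie within \<open>q\<^sup>2 / M\<close> of each
  other, so there are at most \<open>1 + q\<^sup>2 / M\<close>; the 1 is absorbed because
  \<open>M \<le> Q\<^sup>2\<close>.\<close>

lemma card_square_fractions_le_trivial:
  fixes P :: "(nat \<times> nat) set" and \<beta> :: real and M Q :: nat
  assumes "finite P" "M > 0" "M \<le> Q\<^sup>2"
    and P: "\<And>q a. (q, a) \<in> P \<Longrightarrow> in_window \<beta> M Q q a"
  shows "real (card P) \<le> 2 * (real Q)^3 / real M"
proof -
  define A where "A q = {a. (q, a) \<in> P}" for q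
  have finA: "finite (A q)" for q
    by (rule finite_subset[of _ "snd ` P"]) (use assms(1) in \<open>force simp: A_def\<close>)+
  have A_le: "real (card (A q)) \<le> 2 * (real Q)\<^sup>2 / real M" if q: "q \<in> {1..Q}" for q
  proof -
    \<comment> \<open>Modulus 1 in the residue class count bounds a set of integers by its
      spread.\<close>
    have "real (card (int ` A q)) \<le> 1 + ((real q)\<^sup>2 / real M) / real_of_int 1"
    proof (rule card_residue_class_le)
      fix x y assume "x \<in> int ` A q" "y \<in> int ` A q"
      then obtain a a' where *: "x = int a" "y = int a'" "(q, a) \<in> P" "(q, a') \<in> P"
        by (auto simp: A_def)
      have "\<bar>real a / real (q\<^sup>2) - real a' / real (q\<^sup>2)\<bar> \<le> 1 / real M"
        using P[OF *(3)] P[OF *(4)] unfolding in_window_def by linarith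
      then have "\<bar>real a - real a'\<bar> / (real q)\<^sup>2 \<le> 1 / real M"
        by (simp flip: diff_divide_distrib)
      then show "real_of_int \<bar>x - y\<bar> \<le> (real q)\<^sup>2 / real M"
        using * q assms(2) by (simp add: field_simps)
    qed (use finA in auto)
    also have "card (int ` A q) = card (A q)" by (intro card_image) simp
    finally have "real (card (A q)) \<le> 1 + (real q)\<^sup>2 / real M" by simp
    also have "\<dots> \<le> (real Q)\<^sup>2 / real M + (real Q)\<^sup>2 / real M"
    proof (intro add_mono divide_right_mono power_mono)
      have "real M \<le> real (Q\<^sup>2)" using assms(3) by (rule of_nat_mono)
      then show "1 \<le> (real Q)\<^sup>2 / real M" using assms(2) by (simp add: field_simps)
    qed (use q in auto)
    finally show ?thesis by simp
  qed
  have "P \<subseteq> Sigma {1..Q} A" using P by (fastforce simp: A_def in_window_def)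
  then have "card P \<le> card (Sigma {1..Q} A)" using finA by (intro card_mono) auto
  also have "\<dots> = (\<Sum>q=1..Q. card (A q))" using finA by simp
  finally have "real (card P) \<le> (\<Sum>q=1..Q. real (card (A q)))"
    by (metis of_nat_le_iff of_nat_sum)
  also have "\<dots> \<le> real (card {1..Q}) * (2 * (real Q)\<^sup>2 / real M)"
    using A_le by (intro sum_bounded_above)
  finally show ?thesis by (simp add: power2_eq_square power3_eq_cube mult_ac)
qed

section \<open>The large sieve for square moduli\<close>

lemma large_sieve_square_moduli:
  fixes \<epsilon> :: real
  assumes "\<epsilon> > 0"
  obtains C :: real where "C > 0"
    "\<And>(Q::nat) (M::nat) (a :: nat \<Rightarrow> complex). M > 0 \<Longrightarrow>
      (\<Sum>q=1..Q. \<Sum>b\<in>{b\<in>{1..q\<^sup>2}. coprime b q}.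
         (cmod (\<Sum>n=1..M. a n * e (real n * (real b / real (q\<^sup>2)))))\<^sup>2)
      \<le> C * (real Q ^ 3 + real M + real M powr (1/2 + \<epsilon>) * (real Q)\<^sup>2) * (\<Sum>n=1..M. (cmod (a n))\<^sup>2)"
proof -
  \<comment> \<open>The exponent is doubled because \<open>r\<^sup>2 \<le> M\<close> gives
    \<open>r powr (2 * \<epsilon>) \<le> M powr \<epsilon>\<close>.\<close>
  obtain C0 :: real where C0: "C0 > 0"
    "\<And>n::nat. n > 0 \<Longrightarrow> real (card {d. d dvd n}) \<le> C0 * real n powr (2 * \<epsilon>)"
    using card_divisors_bound[of "2 * \<epsilon>"] assms by auto
  \<comment> \<open>The sieve constant 130 meets the count constants: \<open>260 = 130 * 2\<close>
    and \<open>8320 = 130 * 64\<close>.\<close>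
  define C1 where "C1 = 260 + 8320 * C0"
  have C1: "C1 > 0" using C0 by (simp add: C1_def)
  have "(\<Sum>q=1..Q. \<Sum>b\<in>{b\<in>{1..q\<^sup>2}. coprime b q}.
         (cmod (\<Sum>n=1..M. a n * e (real n * (real b / real (q\<^sup>2)))))\<^sup>2)
      \<le> C1 * (real Q ^ 3 + real M + real M powr (1/2 + \<epsilon>) * (real Q)\<^sup>2) * (\<Sum>n=1..M. (cmod (a n))\<^sup>2)"
    if M: "M > 0" for Q M :: nat and a :: "nat \<Rightarrow> complex"
  proof -
    define Z where "Z = (\<Sum>n=1..M. (cmod (a n))\<^sup>2)"
    define Y where "Y = real M powr (1/2 + \<epsilon>) * (real Q)\<^sup>2"
    define W where "W = real Q ^ 3 + real M + Y"
    have Z0: "Z \<ge> 0" by (simp add: Z_def sum_nonneg)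
    have Y0: "Y \<ge> 0" by (simp add: Y_def)
    have W: "real Q ^ 3 \<le> W" "real M \<le> W" "Y \<le> W" "W \<ge> 0"
      using Y0 by (auto simp: W_def)
    define I where "I = Sigma {1..Q} (\<lambda>q. {b\<in>{1..q\<^sup>2}. coprime b q})"
    have finI: "finite I" unfolding I_def by (intro finite_SigmaI) auto
    define \<alpha> where "\<alpha> = (\<lambda>(q, b). real b / real (q\<^sup>2) :: real)"
    have \<alpha>: "0 < \<alpha> i \<and> \<alpha> i \<le> 1" if i: "i \<in> I" for i
    proof -
      obtain q b where qb: "i = (q, b)" "1 \<le> q" "1 \<le> b" "b \<le> q\<^sup>2"
        using i by (auto simp: I_def)
      then have "real b \<le> real (q\<^sup>2)" by (intro of_nat_mono)
      then show ?thesis using qb by (simp add: \<alpha>_def)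
    qed
    have memI: "q > 0 \<and> q \<le> Q \<and> coprime b q" if "(q, b) \<in> I" for q b
      using that by (auto simp: I_def)
    have fin_int: "finite {i\<in>I. \<beta> - 1 / real M < \<alpha> i \<and> \<alpha> i \<le> \<beta>}" for \<beta> using finI by simp
    have sieve: "(\<Sum>i\<in>I. (cmod (\<Sum>n=1..M. a n * e (real n * \<alpha> i)))\<^sup>2) \<le> 130 * K * real M * Z"
      if "\<And>\<beta>. real (card {i\<in>I. \<beta> - 1 / real M < \<alpha> i \<and> \<alpha> i \<le> \<beta>}) \<le> K" for K
      unfolding Z_def using finI M \<alpha> that by (intro large_sieve) auto
    have "(\<Sum>q=1..Q. \<Sum>b\<in>{b\<in>{1..q\<^sup>2}. coprime b q}.
         (cmod (\<Sum>n=1..M. a n * e (real n * (real b / real (q\<^sup>2)))))\<^sup>2)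
        = (\<Sum>i\<in>I. (cmod (\<Sum>n=1..M. a n * e (real n * \<alpha> i)))\<^sup>2)"
      unfolding I_def \<alpha>_def by (subst sum.Sigma) (auto simp: split_def)
    also have "\<dots> \<le> C1 * W * Z"
    \<comment> \<open>For \<open>Q\<^sup>2 \<le> M\<close> the Dirichlet count makes
      \<open>K * M\<close> equal to \<open>M\<close> plus a multiple of \<open>Y\<close>; otherwise
      counting each \<open>q\<close> separately gives \<open>K * M = 2 * Q ^ 3\<close>.\<close>
    proof (cases "Q\<^sup>2 \<le> M")
      case True
      define K where "K = 1 + 64 * (C0 * real M powr \<epsilon>) * (real Q)\<^sup>2 / sqrt (real M)"
      have "real (card {i\<in>I. \<beta> - 1 / real M < \<alpha> i \<and> \<alpha> i \<le> \<beta>}) \<le> K" for \<beta>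
      proof -
        obtain r :: nat where r: "r > 0" "r\<^sup>2 \<le> M"
          "real (card {i\<in>I. \<beta> - 1 / real M < \<alpha> i \<and> \<alpha> i \<le> \<beta>})
            \<le> 1 + 64 * real (card {d. d dvd r}) * (real Q)\<^sup>2 / sqrt (real M)"
          by (rule card_square_fractions_le[OF fin_int[of \<beta>] M True, of \<beta>])
             (use memI in \<open>auto simp: \<alpha>_def in_window_def\<close>)
        have "real (card {d. d dvd r}) \<le> C0 * real r powr (2 * \<epsilon>)" by (rule C0(2)[OF r(1)])
        also have "real r powr (2 * \<epsilon>) = real (r\<^sup>2) powr \<epsilon>"
          using r(1) by (simp add: powr_powr flip: powr_numeral)
        also have "\<dots> \<le> real M powr \<epsilon>"
          using r(2) assms by (intro powr_mono2 of_nat_mono) auto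
        finally have "real (card {d. d dvd r}) \<le> C0 * real M powr \<epsilon>" using C0(1) by simp
        then have "1 + 64 * real (card {d. d dvd r}) * (real Q)\<^sup>2 / sqrt (real M) \<le> K"
          unfolding K_def by (intro add_left_mono divide_right_mono mult_right_mono mult_left_mono) auto
        then show ?thesis using r(3) by linarith
      qed
      then have "(\<Sum>i\<in>I. (cmod (\<Sum>n=1..M. a n * e (real n * \<alpha> i)))\<^sup>2) \<le> 130 * (K * real M) * Z"
        using sieve[of K] by (simp add: mult.assoc)
      also have "\<dots> \<le> C1 * W * Z"
      proof (rule mult_right_mono[OF _ Z0])
        have "K * real M = real M + 64 * C0 * (real M powr \<epsilon> * (real M / sqrt (real M))) * (real Q)\<^sup>2"
          unfolding K_def by (simp add: algebra_simps)
        also have "real M / sqrt (real M) = sqrt (real M)" by (rule real_div_sqrt) simp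
        also have "real M powr \<epsilon> * sqrt (real M) = real M powr (1/2 + \<epsilon>)"
          by (simp add: powr_add flip: powr_half_sqrt)
        finally have "130 * (K * real M) = 130 * real M + 8320 * (C0 * Y)" by (simp add: Y_def)
        also have "\<dots> \<le> 260 * W + 8320 * (C0 * W)"
          using W C0(1) by (intro add_mono mult_left_mono mult_mono) auto
        also have "\<dots> = C1 * W" by (simp add: C1_def algebra_simps)
        finally show "130 * (K * real M) \<le> C1 * W" .
      qed
      finally show ?thesis .
    next
      case False
      define K where "K = 2 * (real Q)^3 / real M"
      have "real (card {i\<in>I. \<beta> - 1 / real M < \<alpha> i \<and> \<alpha> i \<le> \<beta>}) \<le> K" for \<beta>
        unfolding K_def using False
        by (intro card_square_fractions_le_trivial[OF fin_int M, where \<beta> = \<beta>])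
           (use memI in \<open>auto simp: \<alpha>_def in_window_def\<close>)
      then have "(\<Sum>i\<in>I. (cmod (\<Sum>n=1..M. a n * e (real n * \<alpha> i)))\<^sup>2) \<le> 130 * K * real M * Z"
        by (rule sieve)
      also have "\<dots> = 260 * (real Q)^3 * Z"
        using M by (simp add: K_def)
      also have "\<dots> \<le> C1 * W * Z"
        using W C0(1) by (intro mult_right_mono[OF mult_mono Z0]) (auto simp: C1_def)
      finally show ?thesis .
    qed
    finally show ?thesis unfolding W_def Y_def Z_def .
  qed
  then show thesis using that C1 by blast
qed

section \<open>Real parameters and the log log factor\<close>

lemma pos_upto_eq: "pos_upto x = {1..nat \<lfloor>x\<rfloor>}"
  unfolding pos_upto_def by (auto simp: le_nat_floor) linarith

theorem theorem3:
  fixes \<epsilon> :: real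
  assumes "\<epsilon> > 0"
  shows "\<exists>C::real. C > 0 \<and>
    (\<forall>(Q\<^sub>1::real) (N::real) (a :: nat \<Rightarrow> complex). Q\<^sub>1 \<ge> 1 \<longrightarrow> N \<ge> 1 \<longrightarrow>
      (\<Sum>q\<in>pos_upto Q\<^sub>1. \<Sum>b\<in>{b\<in>{1..q^2}. coprime b q}.
         (cmod (trig_poly a N (real b / real (q^2))))^2)
      \<le> C * (ln (ln (10 * N * Q\<^sub>1)))^2
          * (Q\<^sub>1^3 + N + N powr (1/2 + \<epsilon>) * Q\<^sub>1^2)
          * (\<Sum>n\<in>pos_upto N. (cmod (a n))^2))"
proof -
  obtain C where C: "C > 0"
    "\<And>(Q::nat) (M::nat) (a :: nat \<Rightarrow> complex). M > 0 \<Longrightarrow>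
      (\<Sum>q=1..Q. \<Sum>b\<in>{b\<in>{1..q\<^sup>2}. coprime b q}.
         (cmod (\<Sum>n=1..M. a n * e (real n * (real b / real (q\<^sup>2)))))\<^sup>2)
      \<le> C * (real Q ^ 3 + real M + real M powr (1/2 + \<epsilon>) * (real Q)\<^sup>2) * (\<Sum>n=1..M. (cmod (a n))\<^sup>2)"
    using large_sieve_square_moduli[OF assms] by blast
  \<comment> \<open>The bound obtained so far has no log log factor. Since
    \<open>10 * N * Q\<^sub>1 \<ge> 10\<close>, that factor is at least \<open>\<mu>\<close>, which
    is positive because \<open>10 > exp 1\<close>; the constant \<open>C / \<mu>\<close> therefore
    suffices.\<close>
  define \<mu> where "\<mu> = (ln (ln (10::real)))\<^sup>2"
  have "exp 1 < (10::real)" using exp_le by linarith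
  then have "ln (exp 1) < ln (10::real)" by (subst ln_less_cancel_iff) auto
  then have ln10: "ln (10::real) > 1" by simp
  then have \<mu>: "\<mu> > 0" by (simp add: \<mu>_def)
  show ?thesis
  proof (intro exI[of _ "C / \<mu>"] conjI allI impI)
    show "C / \<mu> > 0" using C(1) \<mu> by simp
    fix Q\<^sub>1 N :: real and a :: "nat \<Rightarrow> complex"
    assume Q1: "Q\<^sub>1 \<ge> 1" and N1: "N \<ge> 1"
    define Q where "Q = nat \<lfloor>Q\<^sub>1\<rfloor>"
    define M where "M = nat \<lfloor>N\<rfloor>"
    define Z where "Z = (\<Sum>n\<in>pos_upto N. (cmod (a n))\<^sup>2)"
    define W where "W = Q\<^sub>1^3 + N + N powr (1/2 + \<epsilon>) * Q\<^sub>1\<^sup>2"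
    have Z0: "Z \<ge> 0" by (simp add: Z_def sum_nonneg)
    have Q: "real Q \<le> Q\<^sub>1" using Q1 by (simp add: Q_def)
    have M: "M > 0" "real M \<le> N" using N1 by (simp_all add: M_def)
    have "(\<Sum>q\<in>pos_upto Q\<^sub>1. \<Sum>b\<in>{b\<in>{1..q^2}. coprime b q}.
         (cmod (trig_poly a N (real b / real (q^2))))^2)
        \<le> C * (real Q ^ 3 + real M + real M powr (1/2 + \<epsilon>) * (real Q)\<^sup>2) * Z"
      using C(2)[OF M(1), of a Q] unfolding trig_poly_def pos_upto_eq Z_def Q_def M_def .
    also have "\<dots> \<le> C * W * Z"
      unfolding W_def using Q M(2) C(1) assms
      by (intro mult_right_mono[OF mult_left_mono Z0] add_mono mult_mono powr_mono2 power_mono) auto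
    also have "\<dots> = C / \<mu> * \<mu> * W * Z" using \<mu> by simp
    also have "\<dots> \<le> C / \<mu> * (ln (ln (10 * N * Q\<^sub>1)))\<^sup>2 * W * Z"
    proof -
      have "1 * 1 \<le> N * Q\<^sub>1" using Q1 N1 by (intro mult_mono) auto
      then have "10 \<le> 10 * N * Q\<^sub>1" by simp
      then have "ln 10 \<le> ln (10 * N * Q\<^sub>1)" by (subst ln_le_cancel_iff) auto
      then have "ln (ln 10) \<le> ln (ln (10 * N * Q\<^sub>1))" using ln10 by (subst ln_le_cancel_iff) auto
      moreover have "ln (ln (10::real)) \<ge> 0" using ln10 by simp
      ultimately have "\<mu> \<le> (ln (ln (10 * N * Q\<^sub>1)))\<^sup>2" unfolding \<mu>_def by (intro power_mono)
      moreover have "W \<ge> 0" using Q1 N1 by (simp add: W_def)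
      ultimately show ?thesis using C(1) \<mu> Z0
        by (intro mult_right_mono mult_left_mono) auto
    qed
    finally show "(\<Sum>q\<in>pos_upto Q\<^sub>1. \<Sum>b\<in>{b\<in>{1..q^2}. coprime b q}.
         (cmod (trig_poly a N (real b / real (q^2))))^2)
      \<le> C / \<mu> * (ln (ln (10 * N * Q\<^sub>1)))^2
          * (Q\<^sub>1^3 + N + N powr (1/2 + \<epsilon>) * Q\<^sub>1^2)
          * (\<Sum>n\<in>pos_upto N. (cmod (a n))^2)"
      unfolding W_def Z_def .
  qed
qed

end
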